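(* Let $T>0$, $\varepsilon>0$ and $c>0$. For each integer $N\ge 2$ let $\{\phi^{i}_t=\phi^{i,(N)}_t\}$ be the solution of the finite periodic Riccati system of size $N$ (see context), and let $\{\varphi^{i}_t : i\in\mathbb N_0,\ 0\le t\le T\}$ be the solution of the infinite Riccati system (see context). Then for every fixed $i\in\mathbb N_0$ and $t\in[0,T]$, $$\lim_{N\to\infty}\sum_{j=0}^{N-1}\phi^{j,(N)}_t\,\phi^{N+i-j,(N)}_t=\sum_{j=0}^{i}\varphi^j_t\,\varphi^{i-j}_t \qquad\text{and}\qquad \lim_{N\to\infty}\sum_{j=i+1}^{N-1}\phi^{j,(N)}_t\,\phi^{N+i-j,(N)}_t=0 .$$
   Context: $\mathbb N_0=\{0,1,2,\dots\}$. Superscripts on $\phi,\varphi,\varepsilon$ are indices, not powers; a dot denotes $\frac{d}{dt}$. Put $\varepsilon^0:=\varepsilon$, $\varepsilon^1:=-\varepsilon$, $\varepsilon^i:=0$ for $i\ge 2$. Infinite Riccati system: real-valued functions $\varphi^i_t$, $i\in\mathbb N_0$, $0\le t\le T$, with $$\dot\varphi^i_t=\sum_{j=0}^{i}\varphi^j_t\,\varphi^{i-j}_t-\varepsilon^i,\qquad \varphi^0_T=c,\quad \varphi^1_T=-c,\quad \varphi^i_T=0\ (i\ge 2).$$ It has a unique solution on $[0,T]$. Finite periodic Riccati system of size $N\ge 2$: real-valued functions $\phi^i_t$, $i=0,\dots,N-1$, $0\le t\le T$, extended to all $i\in\mathbb Z$ by periodicity $\phi^{i+N}_t=\phi^i_t$,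 with $$\dot\phi^i_t=\sum_{j=0}^{N-1}\phi^j_t\,\phi^{N+i-j}_t-\varepsilon^i,\qquad \phi^0_T=c,\quad \phi^1_T=-c,\quad \phi^i_T=0\ (2\le i\le N-1).$$ It has a unique solution on $[0,T]$, which depends on $N$; this is indicated by writing $\phi^{i,(N)}_t$. *)

theory Defs
  imports "HOL-Analysis.Analysis"
begin

definition eps_coeff :: "real \<Rightarrow> nat \<Rightarrow> real" where
  "eps_coeff \<epsilon> i = (if i = 0 then \<epsilon> else if i = 1 then - \<epsilon> else 0)"

(* Derivatives are taken within the interval {0..T}, hence one-sided at 0 and T. *)

definition infinite_riccati_solution ::
  "real \<Rightarrow> real \<Rightarrow> real \<Rightarrow> (nat \<Rightarrow> real \<Rightarrow> real) \<Rightarrow> bool" where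
  "infinite_riccati_solution T \<epsilon> c \<phi> \<longleftrightarrow>
     (\<forall>i. \<forall>t\<in>{0..T}.
        (\<phi> i has_real_derivative ((\<Sum>j=0..i. \<phi> j t * \<phi> (i - j) t) - eps_coeff \<epsilon> i))
          (at t within {0..T})) \<and>
     \<phi> 0 T = c \<and> \<phi> 1 T = - c \<and> (\<forall>i\<ge>2. \<phi> i T = 0)"

(* The index of the solution ranges over all integers because the family is
   extended N-periodically; the differential equation and the terminal conditions
   concern the representatives 0, ..., N - 1 only. *)

definition periodic_riccati_solution ::
  "real \<Rightarrow> real \<Rightarrow> real \<Rightarrow> nat \<Rightarrow> (int \<Rightarrow> real \<Rightarrow> real) \<Rightarrow> bool" where
  "periodic_riccati_solution T \<epsilon> c N \<phi> \<longleftrightarrow>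
     (\<forall>i. \<forall>t\<in>{0..T}. \<phi> (i + int N) t = \<phi> i t) \<and>
     (\<forall>i<N. \<forall>t\<in>{0..T}.
        (\<phi> (int i) has_real_derivative
           ((\<Sum>j=0..<N. \<phi> (int j) t * \<phi> (int N + int i - int j) t) - eps_coeff \<epsilon> i))
          (at t within {0..T})) \<and>
     \<phi> 0 T = c \<and> \<phi> 1 T = - c \<and> (\<forall>i. 2 \<le> i \<and> i < N \<longrightarrow> \<phi> (int i) T = 0)"

end

(* For i >= 1 the components psi^i are nonpositive, because the nonlinear part of their equation
   has a sign. For rho slightly above 1 the weighted partial sums of psi^i rho^i satisfy a scalar
   Riccati inequality and so are bounded below; together with the signs this yields
   |psi^i| <= C rho^(-i), uniformly in t. Hence the aliased sums chi^i = sum_m psi^(i + m N)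
   converge, and as aliasing turns convolution into cyclic convolution, chi solves the periodic
   system of size N. By uniqueness chi is its solution, and the first sum in the theorem equals
   sum_m (psi * psi)^(i + m N), whose terms with m >= 1 are O(rho^(-N)). *)

theory Submission
  imports Defs
begin

section \<open>Backward comparison and boundedness on a compact interval\<close>

text \<open>For an antiderivative \<open>A\<close> of \<open>a\<close>, the product of
  \<open>f\<close> and \<open>exp (- A)\<close> is nondecreasing, so its sign at \<open>T\<close> is
  inherited by all earlier times. This Gronwall-type tool serves for the signs, the weighted lower
  bound and uniqueness.\<close>

lemma terminal_comparison_nonpos:
  fixes f f' a :: "real \<Rightarrow> real"
  assumes der: "\<And>t. t \<in> {0..T} \<Longrightarrow> (f has_real_derivative f' t) (at t within {0..T})"
    and cont: "continuous_on {0..T} a"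
    and le: "\<And>t. t \<in> {0..T} \<Longrightarrow> a t * f t \<le> f' t"
    and terminal: "f T \<le> 0"
    and t: "t \<in> {0..T}"
  shows "f t \<le> 0"
proof -
  obtain A where A: "\<And>s. s \<in> {0..T} \<Longrightarrow> (A has_real_derivative a s) (at s within {0..T})"
    using antiderivative_continuous[OF cont] has_real_derivative_iff_has_vector_derivative by metis
  define h where "h s = f s * exp (- A s)" for s
  have h: "(h has_real_derivative (f' s - a s * f s) * exp (- A s)) (at s within {0..T})"
    if "s \<in> {0..T}" for s
    unfolding h_def
    using der[OF that] A[OF that] by (auto intro!: derivative_eq_intros simp: algebra_simps)
  have "h t \<le> h T"
  proof (rule DERIV_nonneg_imp_increasing_open[where f = h])
    show "t \<le> T" using t by simp
    show "\<exists>y. (h has_real_derivative y) (at x) \<and> 0 \<le> y" if "t < x" "x < T" for x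
    proof (intro exI conjI)
      have "x \<in> {0..T}" "at x within {0..T} = at x"
        using that t by (auto intro: at_within_Icc_at)
      with h[of x] show "(h has_real_derivative (f' x - a x * f x) * exp (- A x)) (at x)"
        by simp
      show "0 \<le> (f' x - a x * f x) * exp (- A x)"
        using le[OF \<open>x \<in> {0..T}\<close>] by simp
    qed
    have "continuous_on {0..T} h"
      using h by (intro DERIV_continuous_on) auto
    then show "continuous_on {t..T} h"
      by (rule continuous_on_subset) (use t in auto)
  qed
  also have "h T \<le> 0"
    unfolding h_def using terminal by (simp add: mult_nonpos_nonneg)
  finally show ?thesis
    unfolding h_def by (simp add: mult_le_0_iff)
qed

lemma continuous_on_Icc_abs_bound:
  fixes f :: "real \<Rightarrow> real"
  assumes "continuous_on {a..b} f"
  shows "\<exists>B. \<forall>t\<in>{a..b}. \<bar>f t\<bar> \<le> B"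
proof -
  have "bounded (f ` {a..b})"
    using assms by (intro compact_imp_bounded compact_continuous_image) auto
  then show ?thesis
    by (simp add: bounded_iff del: atLeastAtMost_iff)
qed

section \<open>Signs and geometric decay for the infinite system\<close>

lemma infinite_riccati_deriv:
  assumes "infinite_riccati_solution T \<epsilon> c \<psi>" "t \<in> {0..T}"
  shows "(\<psi> i has_real_derivative (\<Sum>j\<le>i. \<psi> j t * \<psi> (i - j) t) - eps_coeff \<epsilon> i) (at t within {0..T})"
  using assms unfolding infinite_riccati_solution_def atMost_atLeast0 by blast

lemma infinite_riccati_terminal:
  assumes "infinite_riccati_solution T \<epsilon> c \<psi>"
  shows "\<psi> i T = eps_coeff c i"
proof -
  have "i = 0 \<or> i = 1 \<or> i \<ge> 2" by linarith
  then show ?thesis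
    using assms unfolding infinite_riccati_solution_def eps_coeff_def by auto
qed

lemma infinite_riccati_continuous:
  assumes "infinite_riccati_solution T \<epsilon> c \<psi>"
  shows "continuous_on {0..T} (\<psi> i)"
  using infinite_riccati_deriv[OF assms] by (intro DERIV_continuous_on) auto

text \<open>Strong induction on \<open>i\<close>. The terms \<open>j = 0\<close> and
  \<open>j = i\<close> of the convolution form a linear part with coefficient
  \<open>2 * \<psi> 0\<close>; the remaining products have two nonpositive factors, and the source
  \<open>- eps_coeff \<epsilon> i\<close> is nonnegative for \<open>i \<ge> 1\<close>. Linear
  comparison then applies.\<close>

lemma infinite_riccati_nonpos:
  assumes sol: "infinite_riccati_solution T \<epsilon> c \<psi>"
    and "\<epsilon> > 0" "c > 0" and "i \<ge> 1" "t \<in> {0..T}"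
  shows "\<psi> i t \<le> 0"
  using \<open>i \<ge> 1\<close> \<open>t \<in> {0..T}\<close>
proof (induction i arbitrary: t rule: less_induct)
  case (less i)
  show ?case
  proof (rule terminal_comparison_nonpos[OF infinite_riccati_deriv[OF sol]])
    show "continuous_on {0..T} (\<lambda>t. 2 * \<psi> 0 t)"
      by (intro continuous_intros infinite_riccati_continuous[OF sol])
    show "\<psi> i T \<le> 0"
      unfolding infinite_riccati_terminal[OF sol] eps_coeff_def using less.prems \<open>c > 0\<close> by simp
    show "t \<in> {0..T}" by (rule less.prems)
    show "2 * \<psi> 0 s * \<psi> i s \<le> (\<Sum>j\<le>i. \<psi> j s * \<psi> (i - j) s) - eps_coeff \<epsilon> i"
      if "s \<in> {0..T}" for s
    proof -
      have "{..i} = insert 0 (insert i {1..<i})"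
        using less.prems by auto
      then have "(\<Sum>j\<le>i. \<psi> j s * \<psi> (i - j) s)
          = 2 * \<psi> 0 s * \<psi> i s + (\<Sum>j=1..<i. \<psi> j s * \<psi> (i - j) s)"
        using less.prems by simp
      moreover have "0 \<le> (\<Sum>j=1..<i. \<psi> j s * \<psi> (i - j) s)"
        using that by (intro sum_nonneg mult_nonpos_nonpos less.IH) auto
      moreover have "eps_coeff \<epsilon> i \<le> 0"
        using less.prems \<open>\<epsilon> > 0\<close> by (simp add: eps_coeff_def)
      ultimately show ?thesis by linarith
    qed
  qed
qed

text \<open>The square sums over the full box of pairs. A pair in the box with
  \<open>j + k > n\<close> has both indices positive, so the products missing on the left are
  nonnegative.\<close>

lemma triangle_sum_le_square:
  fixes x :: "nat \<Rightarrow> real"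
  assumes "\<And>i. i \<ge> 1 \<Longrightarrow> x i \<le> 0"
  shows "(\<Sum>k\<le>n. \<Sum>j\<le>k. x j * x (k - j)) \<le> (\<Sum>k\<le>n. x k)\<^sup>2"
proof -
  have "(\<Sum>k\<le>n. \<Sum>j\<le>k. x j * x (k - j)) = (\<Sum>(j, k)\<in>{(j, k). j + k \<le> n}. x j * x k)"
    by (simp add: sum.triangle_reindex_eq)
  also have "\<dots> \<le> (\<Sum>(j, k)\<in>{..n} \<times> {..n}. x j * x k)"
    by (intro sum_mono2) (auto intro!: mult_nonpos_nonpos assms)
  also have "\<dots> = (\<Sum>k\<le>n. x k)\<^sup>2"
    by (simp add: power2_eq_square sum_product sum.cartesian_product)
  finally show ?thesis .
qed

lemma eps_coeff_sum:
  assumes "n \<ge> 1"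
  shows "(\<Sum>i\<le>n. eps_coeff e i * \<rho> ^ i) = e * (1 - \<rho>)"
proof -
  have "(\<Sum>i\<le>n. eps_coeff e i * \<rho> ^ i) = (\<Sum>i\<in>{0, 1}. eps_coeff e i * \<rho> ^ i)"
    using assms by (intro sum.mono_neutral_right) (auto simp: eps_coeff_def)
  then show ?thesis by (simp add: eps_coeff_def algebra_simps)
qed

text \<open>The point is a bound independent of \<open>n\<close> with a weight
  \<open>\<rho> > 1\<close>: this is the source of geometric decay. Finite partial sums are used
  because convergence of the series at \<open>\<rho>\<close> is not yet known; the signs make the
  truncation close up into a scalar inequality.\<close>

lemma infinite_riccati_weighted_sum_ge:
  fixes T \<epsilon> c :: real
  defines "\<beta> \<equiv> 1 / (4 * (1 + T)\<^sup>2)"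
  defines "\<rho> \<equiv> 1 + \<beta> / (c + 2 * \<epsilon>)"
  assumes sol: "infinite_riccati_solution T \<epsilon> c \<psi>"
    and pos: "T > 0" "\<epsilon> > 0" "c > 0" and n: "n \<ge> 1" and t: "t \<in> {0..T}"
  shows "(\<Sum>i\<le>n. \<psi> i t * \<rho> ^ i) \<ge> - 1"
proof -
  \<comment> \<open>\<open>\<beta>\<close> and \<open>\<rho>\<close> are chosen such that the line \<open>q\<close> satisfies
     \<open>q' \<ge> q\<^sup>2 + \<epsilon> (\<rho> - 1)\<close>, whereas the weighted partial sum has \<open>P' \<le> P\<^sup>2 + \<epsilon> (\<rho> - 1)\<close>.\<close>
  define \<alpha> where "\<alpha> = c * (\<rho> - 1)"
  define q where "q s = - \<alpha> - \<beta> * (T - s)" for s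
  define P where "P s = (\<Sum>i\<le>n. \<psi> i s * \<rho> ^ i)" for s
  have \<beta>: "\<beta> > 0" "\<beta> * (1 + T)\<^sup>2 = 1 / 4"
    using pos by (auto simp: \<beta>_def)
  have \<rho>: "\<rho> > 1" using pos \<beta> by (simp add: \<rho>_def)
  \<comment> \<open>The denominator \<open>c + 2 * \<epsilon>\<close> in \<open>\<rho>\<close> is
    made for this estimate and the next one; the factor 4 in \<open>\<beta>\<close> then bounds the
    square of \<open>q\<close> by \<open>\<beta> / 4\<close>.\<close>
  have \<alpha>: "0 \<le> \<alpha>" "\<alpha> \<le> \<beta>"
    using pos \<beta> by (auto simp: \<alpha>_def \<rho>_def field_simps)
  have \<delta>: "\<epsilon> * (\<rho> - 1) \<le> \<beta> / 2"
    using pos \<beta> by (auto simp: \<rho>_def field_simps)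
  have q_le: "\<bar>q s\<bar> \<le> \<beta> * (1 + T)" if "s \<in> {0..T}" for s
  proof -
    have "\<beta> * (T - s) \<le> \<beta> * T" "0 \<le> \<beta> * (T - s)" using that \<beta> by auto
    then show ?thesis using \<alpha> by (simp add: q_def algebra_simps)
  qed
  have q_sq: "(q s)\<^sup>2 + \<epsilon> * (\<rho> - 1) \<le> \<beta>" if "s \<in> {0..T}" for s
  proof -
    have "(q s)\<^sup>2 \<le> (\<beta> * (1 + T))\<^sup>2"
      using q_le[OF that] by (rule abs_le_square_iff[THEN iffD1, OF order.trans]) simp
    also have "\<dots> = \<beta> * (\<beta> * (1 + T)\<^sup>2)"
      by (simp add: power2_eq_square algebra_simps)
    also have "\<dots> = \<beta> / 4" by (simp add: \<beta>)
    finally show ?thesis using \<delta> \<beta> by linarith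
  qed
  define P' where "P' s = (\<Sum>i\<le>n. ((\<Sum>j\<le>i. \<psi> j s * \<psi> (i - j) s) - eps_coeff \<epsilon> i) * \<rho> ^ i)" for s
  have der: "((\<lambda>s. q s - P s) has_real_derivative \<beta> - P' s) (at s within {0..T})"
    if "s \<in> {0..T}" for s
    unfolding P_def q_def P'_def
    by (rule derivative_eq_intros infinite_riccati_deriv[OF sol that] refl)+ (auto intro!: sum.cong simp: algebra_simps)
  have P'_le: "P' s \<le> (P s)\<^sup>2 + \<epsilon> * (\<rho> - 1)" if "s \<in> {0..T}" for s
  proof -
    have "P' s = (\<Sum>i\<le>n. \<Sum>j\<le>i. \<psi> j s * \<psi> (i - j) s * \<rho> ^ i) - (\<Sum>i\<le>n. eps_coeff \<epsilon> i * \<rho> ^ i)"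
      unfolding P'_def by (simp add: left_diff_distrib sum_subtractf sum_distrib_right)
    also have "(\<Sum>i\<le>n. \<Sum>j\<le>i. \<psi> j s * \<psi> (i - j) s * \<rho> ^ i)
        = (\<Sum>i\<le>n. \<Sum>j\<le>i. (\<psi> j s * \<rho> ^ j) * (\<psi> (i - j) s * \<rho> ^ (i - j)))"
      by (intro sum.cong refl) (simp add: mult_ac flip: power_add)
    also have "\<dots> \<le> (P s)\<^sup>2"
      unfolding P_def using infinite_riccati_nonpos[OF sol pos(2,3) _ that] \<rho>
      by (intro triangle_sum_le_square) (simp add: mult_le_0_iff)
    finally show ?thesis using eps_coeff_sum[OF n, of \<epsilon> \<rho>] by (simp add: algebra_simps)
  qed
  have "q t - P t \<le> 0"
  proof (rule terminal_comparison_nonpos[OF der _ _ _ t])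
    \<comment> \<open>The difference of the squares of \<open>q\<close> and \<open>P\<close> factors
      as \<open>(q + P) * (q - P)\<close>, which turns the quadratic inequalities into a linear one
      for \<open>q - P\<close>.\<close>
    show "continuous_on {0..T} (\<lambda>s. q s + P s)"
      unfolding q_def P_def by (intro continuous_intros infinite_riccati_continuous[OF sol])
    show "(q s + P s) * (q s - P s) \<le> \<beta> - P' s" if "s \<in> {0..T}" for s
      using q_sq[OF that] P'_le[OF that] by (simp add: power2_eq_square algebra_simps)
    \<comment> \<open>This value is \<open>- \<alpha>\<close>, so \<open>q\<close> and
      \<open>P\<close> agree at \<open>T\<close>.\<close>
    have "P T = c * (1 - \<rho>)"
      unfolding P_def infinite_riccati_terminal[OF sol] by (rule eps_coeff_sum[OF n])
    then show "q T - P T \<le> 0"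
      by (simp add: q_def \<alpha>_def algebra_simps)
  qed
  moreover have "\<beta> * (1 + T) \<le> 1"
  proof -
    have "\<beta> * (1 + T) * 1 \<le> \<beta> * (1 + T) * (1 + T)"
      using \<beta> pos by (intro mult_left_mono) auto
    then show ?thesis using \<beta>(2) by (simp add: power2_eq_square algebra_simps)
  qed
  ultimately show ?thesis using q_le[OF t] unfolding P_def by linarith
qed

text \<open>Since only \<open>\<psi> 0\<close> can be positive, a lower bound on the signed weighted
  sums bounds the sums of absolute values as well. The decay rate is
  \<open>r = 1 / \<rho>\<close>.\<close>

lemma infinite_riccati_geometric_bound:
  assumes sol: "infinite_riccati_solution T \<epsilon> c \<psi>" and pos: "T > 0" "\<epsilon> > 0" "c > 0"
  obtains C r :: real where "0 < r" "r < 1"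
    "\<And>i t. t \<in> {0..T} \<Longrightarrow> \<bar>\<psi> i t\<bar> \<le> C * r ^ i"
    "\<And>i t. t \<in> {0..T} \<Longrightarrow> \<bar>\<Sum>j\<le>i. \<psi> j t * \<psi> (i - j) t\<bar> \<le> C\<^sup>2 * r ^ i"
proof -
  define \<rho> where "\<rho> = 1 + 1 / (4 * (1 + T)\<^sup>2) / (c + 2 * \<epsilon>)"
  have \<rho>: "\<rho> > 1" using pos by (simp add: \<rho>_def)
  obtain B where B: "\<And>t. t \<in> {0..T} \<Longrightarrow> \<bar>\<psi> 0 t\<bar> \<le> B"
    using continuous_on_Icc_abs_bound[OF infinite_riccati_continuous[OF sol]] by metis
  \<comment> \<open>\<open>2 * B\<close> covers the two occurrences of the zeroth component, and 1
    comes from the weighted lower bound.\<close>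
  define C where "C = 2 * B + 1"
  define x where "x t i = \<bar>\<psi> i t\<bar> * \<rho> ^ i" for t i
  have x_nonneg: "0 \<le> x t i" for t i using \<rho> by (simp add: x_def)
  have sum_le: "(\<Sum>i\<le>n. x t i) \<le> C" if t: "t \<in> {0..T}" for t n
  proof -
    \<comment> \<open>The weighted lower bound requires at least the indices 0 and 1, hence the
      passage to \<open>Suc n\<close>.\<close>
    have "(\<Sum>i\<le>n. x t i) \<le> (\<Sum>i\<le>Suc n. x t i)"
      by (simp add: x_nonneg)
    also have "\<dots> = (\<bar>\<psi> 0 t\<bar> + \<psi> 0 t) - (\<Sum>i\<le>Suc n. \<psi> i t * \<rho> ^ i)"
    proof -
      have "(\<Sum>i\<le>n. x t (Suc i)) = - (\<Sum>i\<le>n. \<psi> (Suc i) t * \<rho> ^ Suc i)"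
        unfolding x_def sum_negf[symmetric]
        by (intro sum.cong refl) (simp add: abs_of_nonpos infinite_riccati_nonpos[OF sol pos(2,3) _ t])
      then show ?thesis
        unfolding sum.atMost_Suc_shift by (simp add: x_def)
    qed
    also have "\<dots> \<le> \<bar>\<psi> 0 t\<bar> + \<psi> 0 t + 1"
      using infinite_riccati_weighted_sum_ge[OF sol pos _ t, of "Suc n"] by (simp add: \<rho>_def)
    also have "\<dots> \<le> C" using B[OF t] by (simp add: C_def)
    finally show ?thesis .
  qed
  have x_le: "x t i \<le> C" if "t \<in> {0..T}" for t i
  proof -
    have "x t i \<le> (\<Sum>i\<le>i. x t i)"
      by (rule member_le_sum) (auto simp: x_nonneg)
    with sum_le[OF that, of i] show ?thesis by simp
  qed
  have C: "0 \<le> C" using x_nonneg[of T 0] x_le[of T 0] pos by simp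
  have "\<bar>\<psi> i t\<bar> \<le> C * (1 / \<rho>) ^ i" if "t \<in> {0..T}" for i t
    using x_le[OF that, of i] \<rho> by (simp add: x_def field_simps)
  moreover have "\<bar>\<Sum>j\<le>i. \<psi> j t * \<psi> (i - j) t\<bar> \<le> C\<^sup>2 * (1 / \<rho>) ^ i" if t: "t \<in> {0..T}" for i t
  proof -
    have "\<bar>\<Sum>j\<le>i. \<psi> j t * \<psi> (i - j) t\<bar> * \<rho> ^ i \<le> (\<Sum>j\<le>i. \<bar>\<psi> j t * \<psi> (i - j) t\<bar>) * \<rho> ^ i"
      using \<rho> by (intro mult_right_mono sum_abs) simp
    also have "\<dots> = (\<Sum>j\<le>i. x t j * x t (i - j))"
      unfolding sum_distrib_right x_def
      by (intro sum.cong refl) (simp add: abs_mult mult_ac flip: power_add)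
    \<comment> \<open>Only one factor is bounded pointwise; the other is summed, which avoids a
      factor \<open>i + 1\<close>.\<close>
    also have "\<dots> \<le> (\<Sum>j\<le>i. x t j * C)"
      by (intro sum_mono mult_left_mono x_le[OF t] x_nonneg)
    also have "\<dots> \<le> C * C"
      unfolding sum_distrib_right[symmetric] by (intro mult_right_mono sum_le[OF t] C)
    finally show ?thesis using \<rho> by (simp add: field_simps power2_eq_square)
  qed
  ultimately show thesis
    using \<rho> by (intro that[of "1 / \<rho>" C]) auto
qed

section \<open>Rearrangement of double series and aliasing of convolutions\<close>

lemma infsum_eq_suminf:
  fixes f :: "nat \<Rightarrow> 'a::banach"
  assumes "summable (\<lambda>n. norm (f n))"
  shows "infsum f UNIV = suminf f"
  by (rule infsumI[OF norm_summable_imp_has_sum[OF assms summable_sums[OF summable_norm_cancel[OF assms]]]])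

lemma summable_progression:
  fixes u :: "nat \<Rightarrow> real"
  assumes "summable (\<lambda>n. \<bar>u n\<bar>)" "N > 0"
  shows "summable (\<lambda>m. \<bar>u (j + m * N)\<bar>)"
proof -
  have "(\<lambda>n. \<bar>u n\<bar>) summable_on UNIV"
    using assms(1) by (simp add: summable_on_UNIV_nonneg_real_iff)
  then have "(\<lambda>n. \<bar>u n\<bar>) summable_on range (\<lambda>m. j + m * N)"
    by (rule summable_on_subset_banach) simp
  moreover have "inj (\<lambda>m. j + m * N)"
    using \<open>N > 0\<close> by (simp add: inj_on_def)
  ultimately have "((\<lambda>n. \<bar>u n\<bar>) \<circ> (\<lambda>m. j + m * N)) summable_on UNIV"
    by (metis summable_on_reindex)
  then show ?thesis
    by (simp add: o_def summable_on_UNIV_nonneg_real_iff)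
qed

text \<open>Unconditional summability over arbitrary sets of pairs is what permits regrouping the
  double series along bijections.\<close>

lemma summable_on_product_nat:
  fixes a b :: "nat \<Rightarrow> real"
  assumes "summable (\<lambda>n. \<bar>a n\<bar>)" "summable (\<lambda>n. \<bar>b n\<bar>)"
  shows "(\<lambda>(p, q). a p * b q) summable_on A"
proof -
  have u: "(\<lambda>n. \<bar>u n\<bar>) summable_on UNIV" if "summable (\<lambda>n. \<bar>u n\<bar>)" for u :: "nat \<Rightarrow> real"
    using that by (simp add: summable_on_UNIV_nonneg_real_iff)
  have "(\<lambda>(p, q). \<bar>a p\<bar> * \<bar>b q\<bar>) summable_on UNIV \<times> UNIV"
  proof (rule summable_on_SigmaI)
    show "((\<lambda>q. case (p, q) of (p, q) \<Rightarrow> \<bar>a p\<bar> * \<bar>b q\<bar>) has_sum \<bar>a p\<bar> * (\<Sum>\<^sub>\<infinity>q. \<bar>b q\<bar>)) UNIV" for p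
      using has_sum_cmult_right[OF has_sum_infsum[OF u[OF assms(2)]]] by simp
    show "(\<lambda>p. \<bar>a p\<bar> * (\<Sum>\<^sub>\<infinity>q. \<bar>b q\<bar>)) summable_on UNIV"
      by (rule summable_on_cmult_left[OF u[OF assms(1)]])
  qed simp
  then have "(\<lambda>x. norm ((\<lambda>(p, q). a p * b q) x)) summable_on UNIV"
    by (simp add: case_prod_unfold abs_mult)
  then have "(\<lambda>(p, q). a p * b q) summable_on UNIV"
    by (rule abs_summable_summable)
  then show ?thesis
    by (rule summable_on_subset_banach) simp
qed

text \<open>This solves the congruence for \<open>q\<close>; the added \<open>N\<close> keeps the
  natural-number subtraction from truncating.\<close>

lemma add_mod_eq_iff:
  fixes N p q i :: nat
  assumes "i < N"
  shows "(p + q) mod N = i \<longleftrightarrow> q mod N = (N + i - p mod N) mod N"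
proof -
  define p' where "p' = p mod N"
  define q' where "q' = q mod N"
  have *: "p' < N" "q' < N" using assms by (auto simp: p'_def q'_def)
  have "(p + q) mod N = (p' + q') mod N"
    by (simp add: p'_def q'_def mod_add_eq)
  also have "\<dots> = (if p' + q' < N then p' + q' else p' + q' - N)"
    using * by (simp add: mod_if)
  finally have 1: "(p + q) mod N = (if p' + q' < N then p' + q' else p' + q' - N)" .
  have 2: "(N + i - p') mod N = (if p' \<le> i then i - p' else N + i - p')"
    using * assms by (simp add: mod_if)
  show ?thesis
    unfolding 1 2 p'_def[symmetric] q'_def[symmetric] using * assms by auto
qed

text \<open>Both sides sum \<open>a p * b q\<close> over all \<open>p + q \<equiv> i (mod N)\<close>.\<close>

lemma cyclic_convolution_aliasing:
  fixes a b :: "nat \<Rightarrow> real"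
  assumes a: "summable (\<lambda>n. \<bar>a n\<bar>)" and b: "summable (\<lambda>n. \<bar>b n\<bar>)" and i: "i < N"
    and conv: "summable (\<lambda>n. \<bar>\<Sum>j\<le>n. a j * b (n - j)\<bar>)"
  shows "(\<Sum>j<N. (\<Sum>m. a (j + m * N)) * (\<Sum>m. b ((N + i - j) mod N + m * N)))
    = (\<Sum>m. \<Sum>j\<le>i + m * N. a j * b (i + m * N - j))"
proof -
  define f where "f = (\<lambda>(p, q). a p * b q)"
  define k where "k j = (N + i - j) mod N" for j
  define S where "S = {(p, q). q mod N = k (p mod N)}"
  have S_eq: "S = {(p, q). (p + q) mod N = i}"
    unfolding S_def k_def add_mod_eq_iff[OF i] ..
  have N: "N > 0" using i by simp
  have kN: "k j < N" for j using N by (simp add: k_def)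
  have f_summable: "f summable_on A" for A
    unfolding f_def by (rule summable_on_product_nat[OF a b])
  \<comment> \<open>First grouping: by the residue \<open>j\<close> of \<open>p\<close>, which
    forces the residue \<open>k j\<close> of \<open>q\<close> and leaves both quotients free. It
    produces products of aliased sums.\<close>
  have bij1: "bij_betw (\<lambda>(j, m, n). (j + m * N, k j + n * N)) ({..<N} \<times> UNIV \<times> UNIV) S"
  proof (rule bij_betwI[where g = "\<lambda>(p, q). (p mod N, p div N, q div N)"])
    show "(\<lambda>(j, m, n). (j + m * N, k j + n * N)) \<in> {..<N} \<times> UNIV \<times> UNIV \<rightarrow> S"
      using kN by (auto simp: S_def)
    show "(\<lambda>(p, q). (p mod N, p div N, q div N)) \<in> S \<rightarrow> {..<N} \<times> UNIV \<times> UNIV"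
      using N by auto
    show "(case (case y of (p, q) \<Rightarrow> (p mod N, p div N, q div N)) of (j, m, n) \<Rightarrow> (j + m * N, k j + n * N)) = y"
      if "y \<in> S" for y
    proof -
      obtain p q where y: "y = (p, q)" by force
      have "k (p mod N) + q div N * N = q"
        using that y by (metis (mono_tags, lifting) S_def case_prodD mem_Collect_eq mod_div_mult_eq)
      then show ?thesis by (simp add: y)
    qed
  qed (use kN in auto)
  \<comment> \<open>Second grouping: by the value \<open>i + m * N\<close> of \<open>p + q\<close>.
    It produces the ordinary convolution along the progression.\<close>
  have bij2: "bij_betw (\<lambda>(m, j). (j, i + m * N - j)) (SIGMA m:UNIV. {..i + m * N}) S"
    unfolding S_eq
  proof (rule bij_betwI[where g = "\<lambda>(p, q). ((p + q) div N, p)"])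
    have *: "i + (p + q) div N * N = p + q" if "(p + q) mod N = i" for p q
      using that mod_div_mult_eq by blast
    show "(\<lambda>(p, q). ((p + q) div N, p)) \<in> {(p, q). (p + q) mod N = i} \<rightarrow> (SIGMA m:UNIV. {..i + m * N})"
      using * by auto
    show "(case (case y of (p, q) \<Rightarrow> ((p + q) div N, p)) of (m, j) \<Rightarrow> (j, i + m * N - j)) = y"
      if "y \<in> {(p, q). (p + q) mod N = i}" for y
      using that * by auto
  qed (use i in auto)
  define g where "g = (\<lambda>(j, m, n). f (j + m * N, k j + n * N))"
  define h where "h = (\<lambda>(m, j). f (j, i + m * N - j))"
  have g_sum: "g summable_on {..<N} \<times> UNIV \<times> UNIV"
    using summable_on_reindex_bij_betw[OF bij1, of f] f_summable[of S]
    by (simp add: g_def case_prod_unfold)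
  have h_sum: "h summable_on (SIGMA m:UNIV. {..i + m * N})"
    using summable_on_reindex_bij_betw[OF bij2, of f] f_summable[of S]
    by (simp add: h_def case_prod_unfold)
  have "(\<Sum>m. a (j + m * N)) * (\<Sum>m. b (k j + m * N)) = (\<Sum>\<^sub>\<infinity>z. g (j, z))" (is "?A * ?B = _")
    if j: "j < N" for j
  proof -
    have "?A * ?B = (\<Sum>\<^sub>\<infinity>m. a (j + m * N)) * (\<Sum>\<^sub>\<infinity>n. b (k j + n * N))"
      using summable_progression[OF a N] summable_progression[OF b N]
      by (simp add: infsum_eq_suminf)
    also have "\<dots> = (\<Sum>\<^sub>\<infinity>m. \<Sum>\<^sub>\<infinity>n. a (j + m * N) * b (k j + n * N))"
      by (simp only: infsum_cmult_right' infsum_cmult_left')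
    also have "\<dots> = (\<Sum>\<^sub>\<infinity>m. \<Sum>\<^sub>\<infinity>n. g (j, m, n))"
      by (simp add: g_def f_def)
    also have "\<dots> = (\<Sum>\<^sub>\<infinity>z\<in>UNIV \<times> UNIV. g (j, z))"
      using summable_on_SigmaD1[of "\<lambda>j z. g (j, z)" "{..<N}" "\<lambda>_. UNIV \<times> UNIV" j] g_sum j
      by (intro infsum_Sigma_banach[where f = "\<lambda>z. g (j, z)"]) (simp add: case_prod_unfold)
    finally show ?thesis by simp
  qed
  then have "(\<Sum>j<N. (\<Sum>m. a (j + m * N)) * (\<Sum>m. b (k j + m * N))) = (\<Sum>j<N. \<Sum>\<^sub>\<infinity>z. g (j, z))"
    by (intro sum.cong) auto
  also have "\<dots> = infsum g ({..<N} \<times> UNIV \<times> UNIV)"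
    using infsum_Sigma_banach[OF g_sum] by simp
  also have "\<dots> = infsum f S"
    using infsum_reindex_bij_betw[OF bij1, of f] by (simp add: g_def case_prod_unfold)
  also have "\<dots> = infsum h (SIGMA m:UNIV. {..i + m * N})"
    using infsum_reindex_bij_betw[OF bij2, of f] by (simp add: h_def case_prod_unfold)
  also have "\<dots> = (\<Sum>\<^sub>\<infinity>m. \<Sum>j\<le>i + m * N. a j * b (i + m * N - j))"
    using infsum_Sigma_banach[OF h_sum] by (simp add: h_def f_def)
  also have "\<dots> = (\<Sum>m. \<Sum>j\<le>i + m * N. a j * b (i + m * N - j))"
    using summable_progression[OF conv N] by (intro infsum_eq_suminf) simp
  finally show ?thesis unfolding k_def .
qed

section \<open>Uniqueness for finite quadratic systems\<close>

text \<open>The energy \<open>E\<close>, the sum of squared differences, satisfies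
  \<open>E' \<ge> - K * E\<close> because both solutions are bounded on the compact interval; as it
  vanishes at \<open>T\<close>, it vanishes before. The map \<open>s\<close> abstracts the cyclic
  index, of which only the range matters.\<close>

lemma quadratic_system_unique:
  fixes u v :: "nat \<Rightarrow> real \<Rightarrow> real" and s :: "nat \<Rightarrow> nat \<Rightarrow> nat"
  assumes u: "\<And>i t. i < N \<Longrightarrow> t \<in> {0..T} \<Longrightarrow>
      (u i has_real_derivative (\<Sum>j<N. u j t * u (s i j) t) - e i) (at t within {0..T})"
    and v: "\<And>i t. i < N \<Longrightarrow> t \<in> {0..T} \<Longrightarrow>
      (v i has_real_derivative (\<Sum>j<N. v j t * v (s i j) t) - e i) (at t within {0..T})"
    and s: "\<And>i j. i < N \<Longrightarrow> j < N \<Longrightarrow> s i j < N"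
    and terminal: "\<And>i. i < N \<Longrightarrow> u i T = v i T"
    and i: "i < N" and t: "t \<in> {0..T}"
  shows "u i t = v i t"
proof -
  have "\<exists>B. \<forall>i<N. \<forall>t\<in>{0..T}. \<bar>w i t\<bar> \<le> B i"
    if "\<And>i. i < N \<Longrightarrow> continuous_on {0..T} (w i)" for w :: "nat \<Rightarrow> real \<Rightarrow> real"
    using continuous_on_Icc_abs_bound[OF that] by metis
  from this[of u] this[of v] obtain Bu Bv where
    Bu: "\<And>i t. i < N \<Longrightarrow> t \<in> {0..T} \<Longrightarrow> \<bar>u i t\<bar> \<le> Bu i" and
    Bv: "\<And>i t. i < N \<Longrightarrow> t \<in> {0..T} \<Longrightarrow> \<bar>v i t\<bar> \<le> Bv i"
    using DERIV_continuous_on[OF u] DERIV_continuous_on[OF v] by blast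
  define B where "B = (\<Sum>i<N. \<bar>Bu i\<bar> + \<bar>Bv i\<bar>)"
  have B_ge: "\<bar>Bu i\<bar> + \<bar>Bv i\<bar> \<le> B" if "i < N" for i
    unfolding B_def using that by (intro member_le_sum) auto
  have B: "\<bar>u i t\<bar> \<le> B" "\<bar>v i t\<bar> \<le> B" if "i < N" "t \<in> {0..T}" for i t
    using Bu[OF that] Bv[OF that] B_ge[OF that(1)] by linarith+
  define d where "d = (\<lambda>i t. u i t - v i t)"
  define E where "E t = (\<Sum>i<N. (d i t)\<^sup>2)" for t
  define E' where "E' t = (\<Sum>i<N. 2 * d i t * (\<Sum>j<N. u j t * u (s i j) t - v j t * v (s i j) t))" for t
  have d: "(d i has_real_derivative (\<Sum>j<N. u j t * u (s i j) t - v j t * v (s i j) t)) (at t within {0..T})"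
    if "i < N" "t \<in> {0..T}" for i t
    using DERIV_diff[OF u[OF that] v[OF that]] by (simp add: d_def sum_subtractf)
  have E: "(E has_real_derivative E' t) (at t within {0..T})" if "t \<in> {0..T}" for t
    unfolding E_def E'_def
    by (intro DERIV_sum) (use d that in \<open>auto intro!: derivative_eq_intros\<close>)
  \<comment> \<open>Each pair of indices contributes two terms, each at least
    \<open>- (2 * B) * E t\<close> by \<open>pair_ge\<close>.\<close>
  define K where "K = (\<Sum>i<N. \<Sum>j<N. 4 * B)"
  have d_le: "(d i t)\<^sup>2 \<le> E t" if "i < N" for i t
    unfolding E_def using that by (intro member_le_sum) auto
  have pair_ge: "2 * d i t * (w * d j t) \<ge> - (2 * B) * E t"
    if "i < N" "j < N" "\<bar>w\<bar> \<le> B" for i j t w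
  proof -
    have "\<bar>2 * d i t * d j t\<bar> \<le> (d i t)\<^sup>2 + (d j t)\<^sup>2"
      using sum_squares_bound[of "\<bar>d i t\<bar>" "\<bar>d j t\<bar>"] by (simp add: abs_mult)
    also have "\<dots> \<le> 2 * E t" using d_le[of i t] d_le[of j t] that by linarith
    finally have "\<bar>w\<bar> * \<bar>2 * d i t * d j t\<bar> \<le> B * (2 * E t)"
      using that by (intro mult_mono) auto
    then have "\<bar>2 * d i t * (w * d j t)\<bar> \<le> 2 * B * E t"
      by (simp add: abs_mult mult_ac)
    then show ?thesis by linarith
  qed
  have "E t \<le> 0"
  proof (rule terminal_comparison_nonpos[OF E _ _ _ t])
    show "continuous_on {0..T} (\<lambda>_. - K)" by simp
    show "E T \<le> 0" by (simp add: E_def d_def terminal)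
    show "- K * E t \<le> E' t" if t: "t \<in> {0..T}" for t
    proof -
      have "- K * E t = (\<Sum>i<N. \<Sum>j<N. - (2 * B) * E t + - (2 * B) * E t)"
        unfolding K_def by (simp add: algebra_simps)
      \<comment> \<open>The difference of the two products is split by inserting the mixed term
        \<open>u j t * v (s i j) t\<close>, so that each part is linear in \<open>d\<close>.\<close>
      also have "\<dots> \<le> (\<Sum>i<N. \<Sum>j<N. 2 * d i t * (u j t * d (s i j) t) + 2 * d i t * (v (s i j) t * d j t))"
        by (intro sum_mono add_mono pair_ge) (auto intro: B s t)
      also have "\<dots> = E' t"
        unfolding E'_def d_def sum_distrib_left
        by (intro sum.cong refl) (simp add: algebra_simps)
      finally show ?thesis .
    qed
  qed
  then have "(d i t)\<^sup>2 \<le> 0" using d_le[OF i, of t] by linarith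
  then show ?thesis by (simp add: d_def)
qed

section \<open>Geometrically bounded sequences along sparse progressions\<close>

text \<open>For \<open>N \<ge> 1\<close> the exponent \<open>i + Suc m * N\<close> is at least
  \<open>N + m\<close>, so the tail is dominated by \<open>C * r ^ N\<close> times a geometric
  series.\<close>

lemma geometric_progression_tail:
  fixes a :: "nat \<Rightarrow> real"
  assumes r: "0 < r" "r < 1" and a: "\<And>n. \<bar>a n\<bar> \<le> C * r ^ n" and "N \<ge> 1"
  shows "\<bar>(\<Sum>m. a (i + m * N)) - a i\<bar> \<le> C * r ^ N / (1 - r)"
proof -
  have C: "0 \<le> C" using a[of 0] by simp
  have le: "\<bar>a (i + Suc m * N)\<bar> \<le> C * r ^ N * r ^ m" for m
  proof -
    have "m \<le> m * N" using \<open>N \<ge> 1\<close> by simp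
    then have "N + m \<le> i + Suc m * N"
      unfolding mult_Suc by linarith
    then have "r ^ (i + Suc m * N) \<le> r ^ (N + m)"
      using r by (simp only: power_decreasing less_imp_le)
    then have "C * r ^ (i + Suc m * N) \<le> C * r ^ (N + m)"
      using C by (rule mult_left_mono)
    with a[of "i + Suc m * N"] show ?thesis by (simp add: power_add mult_ac)
  qed
  have sums: "(\<lambda>m. C * r ^ N * r ^ m) sums (C * r ^ N * (1 / (1 - r)))"
    using r by (intro sums_mult geometric_sums) auto
  have "summable (\<lambda>m. \<bar>a (i + Suc m * N)\<bar>)"
    by (rule summable_comparison_test'[OF sums_summable[OF sums], of 0]) (use le in auto)
  then have summ: "summable (\<lambda>m. a (i + Suc m * N))"
    by (rule summable_rabs_cancel)
  then have "summable (\<lambda>m. a (i + m * N))"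
    by (subst summable_Suc_iff[symmetric])
  then have "(\<Sum>m. a (i + m * N)) - a i = (\<Sum>m. a (i + Suc m * N))"
    using suminf_split_head[of "\<lambda>m. a (i + m * N)"] by simp
  also have "\<bar>\<dots>\<bar> \<le> (\<Sum>m. C * r ^ N * r ^ m)"
    using norm_suminf_le[OF _ sums_summable[OF sums], of "\<lambda>m. a (i + Suc m * N)"] le by simp
  also have "\<dots> = C * r ^ N / (1 - r)"
    using sums_unique[OF sums] by simp
  finally show ?thesis .
qed

lemma summable_abs_geometric_bound:
  fixes a :: "nat \<Rightarrow> real"
  assumes r: "0 < r" "r < 1" and a: "\<And>n. \<bar>a n\<bar> \<le> C * r ^ n"
  shows "summable (\<lambda>n. \<bar>a n\<bar>)"
  by (rule summable_comparison_test'[of "\<lambda>n. C * r ^ n" 0])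
     (use assms in \<open>auto intro: summable_mult summable_geometric\<close>)

lemma tendsto_progression_suminf:
  fixes a :: "nat \<Rightarrow> real"
  assumes r: "0 < r" "r < 1" and a: "\<And>n. \<bar>a n\<bar> \<le> C * r ^ n"
  shows "(\<lambda>N. \<Sum>m. a (i + m * N)) \<longlonglongrightarrow> a i"
proof (rule LIM_zero_cancel, rule Lim_null_comparison)
  \<comment> \<open>At \<open>N = 0\<close> the progression would repeat \<open>a i\<close> forever,
    so the estimate starts at 1.\<close>
  show "\<forall>\<^sub>F N in sequentially. norm ((\<Sum>m. a (i + m * N)) - a i) \<le> C * r ^ N / (1 - r)"
    using geometric_progression_tail[OF assms]
    by (intro eventually_sequentiallyI[of 1]) auto
  have "(\<lambda>N. C * r ^ N / (1 - r)) \<longlonglongrightarrow> C * 0 / (1 - r)"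
    using r by (intro tendsto_intros) auto
  then show "(\<lambda>N. C * r ^ N / (1 - r)) \<longlonglongrightarrow> 0" by simp
qed

text \<open>As \<open>N \<ge> 2\<close>, every shift by a positive multiple of \<open>N\<close>
  passes index 1. Hence aliasing leaves the source terms and the terminal data unchanged.\<close>

lemma eps_coeff_progression:
  assumes "N \<ge> 2" "i < N"
  shows "eps_coeff e (i + m * N) = (if m = 0 then eps_coeff e i else 0)"
proof (cases m)
  case (Suc k)
  then have "i + m * N \<ge> 2" using assms by simp
  then have "i + m * N \<noteq> 0" "i + m * N \<noteq> 1" by linarith+
  then have "eps_coeff e (i + m * N) = 0" by (simp only: eps_coeff_def if_False)
  then show ?thesis using Suc by simp
qed simp

section \<open>The aliased sums as solution of the periodic system\<close>

text \<open>The decay of the convolutions dominates the differentiated series uniformly in time, so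
  it may be differentiated termwise; the aliasing identity then rewrites the sum of convolutions as
  a cyclic convolution.\<close>

lemma aliased_riccati_deriv:
  assumes sol: "infinite_riccati_solution T \<epsilon> c \<psi>"
    and pos: "\<epsilon> > 0"
    and r: "0 < r" "r < 1"
    and b1: "\<And>i t. t \<in> {0..T} \<Longrightarrow> \<bar>\<psi> i t\<bar> \<le> C * r ^ i"
    and b2: "\<And>i t. t \<in> {0..T} \<Longrightarrow> \<bar>\<Sum>j\<le>i. \<psi> j t * \<psi> (i - j) t\<bar> \<le> C\<^sup>2 * r ^ i"
    and N: "N \<ge> 2" "i < N" and t: "t \<in> {0..T}"
  shows "((\<lambda>t. \<Sum>m. \<psi> (i + m * N) t) has_real_derivative
    (\<Sum>j<N. (\<Sum>m. \<psi> (j + m * N) t) * (\<Sum>m. \<psi> ((N + i - j) mod N + m * N) t)) - eps_coeff \<epsilon> i)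
    (at t within {0..T})"
proof -
  define K where "K n t = (\<Sum>j\<le>n. \<psi> j t * \<psi> (n - j) t)" for n t
  define f' where "f' m t = K (i + m * N) t - eps_coeff \<epsilon> (i + m * N)" for m t
  have pow_le: "r ^ (i + m * N) \<le> r ^ m" for m
  proof -
    have "m \<le> m * N" using N by simp
    then have "m \<le> i + m * N" by (rule trans_le_add2)
    then show ?thesis using r by (simp only: power_decreasing less_imp_le)
  qed
  \<comment> \<open>\<open>0 ^ m\<close> is 1 at \<open>m = 0\<close> and 0 otherwise: only the
    unshifted index carries a source term.\<close>
  have f'_le: "norm (f' m t) \<le> C\<^sup>2 * r ^ m + \<epsilon> * 0 ^ m" if "t \<in> {0..T}" for m t
  proof -
    have "\<bar>K (i + m * N) t\<bar> \<le> C\<^sup>2 * r ^ m"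
      using b2[OF that, of "i + m * N"] mult_left_mono[OF pow_le[of m], of "C\<^sup>2"]
      by (simp add: K_def)
    moreover have "\<bar>eps_coeff \<epsilon> (i + m * N)\<bar> \<le> \<epsilon> * 0 ^ m"
      unfolding eps_coeff_progression[OF N] using pos by (auto simp: eps_coeff_def)
    ultimately show ?thesis unfolding f'_def by simp
  qed
  have M_summable: "summable (\<lambda>m. C\<^sup>2 * r ^ m + \<epsilon> * 0 ^ m)"
    using r by (intro summable_add summable_mult summable_geometric) auto
  have "uniform_limit {0..T} (\<lambda>n t. \<Sum>m<n. f' m t) (\<lambda>t. \<Sum>m. f' m t) sequentially"
    by (rule Weierstrass_m_test[OF f'_le M_summable])
  \<comment> \<open>Termwise differentiation needs convergence of the undifferentiated series at one
    point only.\<close>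
  moreover have "summable (\<lambda>m. \<psi> (i + m * N) t)"
    using summable_progression[OF summable_abs_geometric_bound[OF r b1[OF t]], of N i] N
    by (auto intro: summable_rabs_cancel)
  moreover have "(\<psi> (i + m * N) has_real_derivative f' m s) (at s within {0..T})"
    if "s \<in> {0..T}" for m s
    unfolding f'_def K_def by (rule infinite_riccati_deriv[OF sol that])
  ultimately have "\<exists>g. \<forall>s\<in>{0..T}. (\<lambda>m. \<psi> (i + m * N) s) sums g s
      \<and> (g has_real_derivative (\<Sum>m. f' m s)) (at s within {0..T})"
    by (intro has_field_derivative_series[OF _ _ _ t]) auto
  then obtain g where g: "\<And>s. s \<in> {0..T} \<Longrightarrow> (\<lambda>m. \<psi> (i + m * N) s) sums g s"
      "\<And>s. s \<in> {0..T} \<Longrightarrow> (g has_real_derivative (\<Sum>m. f' m s)) (at s within {0..T})"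
    by blast
  have "((\<lambda>t. \<Sum>m. \<psi> (i + m * N) t) has_real_derivative (\<Sum>m. f' m t)) (at t within {0..T})"
    using g(2)[OF t] unfolding has_field_derivative_def
    by (rule has_derivative_transform[rotated 2]) (use t g(1) in \<open>auto simp: sums_iff\<close>)
  moreover have "(\<Sum>m. f' m t) = (\<Sum>m. K (i + m * N) t) - eps_coeff \<epsilon> i"
  proof -
    have "summable (\<lambda>n. \<bar>K n t\<bar>)"
      unfolding K_def by (rule summable_abs_geometric_bound[OF r b2[OF t]])
    then have "summable (\<lambda>m. K (i + m * N) t)"
      using summable_progression[of "\<lambda>n. K n t" N i] N by (auto intro: summable_rabs_cancel)
    moreover have "(\<lambda>m. eps_coeff \<epsilon> (i + m * N)) sums eps_coeff \<epsilon> i"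
      unfolding eps_coeff_progression[OF N] by (rule sums_single)
    ultimately have "(\<lambda>m. f' m t) sums ((\<Sum>m. K (i + m * N) t) - eps_coeff \<epsilon> i)"
      unfolding f'_def by (intro sums_diff summable_sums)
    then show ?thesis by (rule sums_unique[symmetric])
  qed
  moreover have "(\<Sum>m. K (i + m * N) t)
      = (\<Sum>j<N. (\<Sum>m. \<psi> (j + m * N) t) * (\<Sum>m. \<psi> ((N + i - j) mod N + m * N) t))"
    unfolding K_def
    using cyclic_convolution_aliasing[OF summable_abs_geometric_bound[OF r b1[OF t]]
        summable_abs_geometric_bound[OF r b1[OF t]] N(2)
        summable_abs_geometric_bound[OF r b2[OF t]]] by simp
  ultimately show ?thesis by simp
qed

lemma periodic_riccati_mod:
  assumes "periodic_riccati_solution T \<epsilon> c N \<phi>" "t \<in> {0..T}"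
  shows "\<phi> (int n) t = \<phi> (int (n mod N)) t"
proof -
  have step: "\<phi> (z + int N) t = \<phi> z t" for z
    using assms unfolding periodic_riccati_solution_def by blast
  have "\<phi> (z + int k * int N) t = \<phi> z t" for z k
  proof (induction k)
    case (Suc k)
    then show ?case using step[of "z + int k * int N"] by (simp add: algebra_simps)
  qed simp
  from this[of "int (n mod N)" "n div N"] show ?thesis
    by (simp flip: of_nat_mult of_nat_add)
qed

text \<open>Periodicity reduces the index \<open>N + i - j\<close> modulo \<open>N\<close>, so the
  system involves only the components below \<open>N\<close> and has the form required for
  uniqueness.\<close>

lemma periodic_riccati_eq_aliased:
  assumes per: "periodic_riccati_solution T \<epsilon> c N \<phi>"
    and sol: "infinite_riccati_solution T \<epsilon> c \<psi>"
    and pos: "\<epsilon> > 0"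
    and bounds: "0 < r" "r < 1"
      "\<And>i t. t \<in> {0..T} \<Longrightarrow> \<bar>\<psi> i t\<bar> \<le> C * r ^ i"
      "\<And>i t. t \<in> {0..T} \<Longrightarrow> \<bar>\<Sum>j\<le>i. \<psi> j t * \<psi> (i - j) t\<bar> \<le> C\<^sup>2 * r ^ i"
    and N: "N \<ge> 2" "i < N" and t: "t \<in> {0..T}"
  shows "\<phi> (int i) t = (\<Sum>m. \<psi> (i + m * N) t)"
proof (rule quadratic_system_unique[where u = "\<lambda>i. \<phi> (int i)" and v = "\<lambda>i t. \<Sum>m. \<psi> (i + m * N) t"])
  show "(\<phi> (int i) has_real_derivative
      (\<Sum>j<N. \<phi> (int j) t * \<phi> (int ((N + i - j) mod N)) t) - eps_coeff \<epsilon> i) (at t within {0..T})"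
    if "i < N" "t \<in> {0..T}" for i t
  proof -
    have "(\<Sum>j<N. \<phi> (int j) t * \<phi> (int ((N + i - j) mod N)) t)
        = (\<Sum>j=0..<N. \<phi> (int j) t * \<phi> (int N + int i - int j) t)"
      unfolding lessThan_atLeast0 using periodic_riccati_mod[OF per that(2)]
      by (intro sum.cong refl) (simp add: of_nat_diff flip: periodic_riccati_mod[OF per that(2)])
    then show ?thesis
      using per that unfolding periodic_riccati_solution_def by simp
  qed
  show "\<phi> (int i) T = (\<Sum>m. \<psi> (i + m * N) T)" if "i < N" for i
  proof -
    have "(\<lambda>m. \<psi> (i + m * N) T) sums eps_coeff c i"
      unfolding infinite_riccati_terminal[OF sol] eps_coeff_progression[OF N(1) that]
      by (rule sums_single)
    moreover have "i = 0 \<or> i = 1 \<or> i \<ge> 2" by linarith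
    then have "\<phi> (int i) T = eps_coeff c i"
      using per that unfolding periodic_riccati_solution_def eps_coeff_def by auto
    ultimately show ?thesis by (simp add: sums_iff)
  qed
qed (use aliased_riccati_deriv[OF sol pos bounds N(1)] N t in auto)

section \<open>Passage to the limit in the cyclic sums\<close>

theorem proposition2:
  fixes T \<epsilon> c :: real
    and \<phi> :: "nat \<Rightarrow> int \<Rightarrow> real \<Rightarrow> real"
    and \<psi> :: "nat \<Rightarrow> real \<Rightarrow> real"
  assumes "T > 0" and "\<epsilon> > 0" and "c > 0"
    and "\<And>N. N \<ge> 2 \<Longrightarrow> periodic_riccati_solution T \<epsilon> c N (\<phi> N)"
    and "infinite_riccati_solution T \<epsilon> c \<psi>"
  shows "\<forall>i::nat. \<forall>t\<in>{0..T}.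
     ((\<lambda>N. \<Sum>j=0..<N. \<phi> N (int j) t * \<phi> N (int N + int i - int j) t)
        \<longlonglongrightarrow> (\<Sum>j=0..i. \<psi> j t * \<psi> (i - j) t)) \<and>
     ((\<lambda>N. \<Sum>j=i+1..<N. \<phi> N (int j) t * \<phi> N (int N + int i - int j) t)
        \<longlonglongrightarrow> 0)"
proof (intro allI ballI)
  fix i :: nat and t :: real
  assume t: "t \<in> {0..T}"
  note sol = assms(5)
  obtain C r where bounds: "0 < r" "r < 1"
      "\<And>i t. t \<in> {0..T} \<Longrightarrow> \<bar>\<psi> i t\<bar> \<le> C * r ^ i"
      "\<And>i t. t \<in> {0..T} \<Longrightarrow> \<bar>\<Sum>j\<le>i. \<psi> j t * \<psi> (i - j) t\<bar> \<le> C\<^sup>2 * r ^ i"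
    by (rule infinite_riccati_geometric_bound[OF sol assms(1-3)]) blast
  have aliased: "\<phi> N (int n) t = (\<Sum>m. \<psi> (n mod N + m * N) t)" if "N \<ge> 2" for N n
    using periodic_riccati_eq_aliased[OF assms(4)[OF that] sol assms(2) bounds that _ t, of "n mod N"]
      periodic_riccati_mod[OF assms(4)[OF that] t, of n] that by simp
  define F where "F N j = \<phi> N (int j) t * \<phi> N (int N + int i - int j) t" for N j
  define K where "K n = (\<Sum>j\<le>n. \<psi> j t * \<psi> (n - j) t)" for n
  have F: "F N j = (\<Sum>m. \<psi> (j + m * N) t) * (\<Sum>m. \<psi> ((N + i - j) mod N + m * N) t)"
    if "N \<ge> 2" "j < N" for N j
    using aliased[OF that(1), of j] aliased[OF that(1), of "N + i - j"] that by (simp add: F_def of_nat_diff)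
  have "(\<lambda>N. \<Sum>j=0..<N. F N j) \<longlonglongrightarrow> K i"
  proof (rule Lim_transform_eventually)
    show "(\<lambda>N. \<Sum>m. K (i + m * N)) \<longlonglongrightarrow> K i"
      using bounds(4)[OF t] unfolding K_def by (rule tendsto_progression_suminf[OF bounds(1,2)])
    show "\<forall>\<^sub>F N in sequentially. (\<Sum>m. K (i + m * N)) = (\<Sum>j=0..<N. F N j)"
    proof (rule eventually_sequentiallyI)
      \<comment> \<open>This gives both \<open>N \<ge> 2\<close>, where the periodic system is
        posed, and \<open>i < N\<close>, so that \<open>i\<close> is its own residue.\<close>
      fix N assume "i + 2 \<le> N"
      then have N: "N \<ge> 2" "i < N" by auto
      have "(\<Sum>j=0..<N. F N j)
          = (\<Sum>j<N. (\<Sum>m. \<psi> (j + m * N) t) * (\<Sum>m. \<psi> ((N + i - j) mod N + m * N) t))"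
        unfolding lessThan_atLeast0 using N by (intro sum.cong refl F) auto
      also have "\<dots> = (\<Sum>m. K (i + m * N))"
        unfolding K_def
        by (rule cyclic_convolution_aliasing[OF summable_abs_geometric_bound[OF bounds(1,2) bounds(3)[OF t]]
              summable_abs_geometric_bound[OF bounds(1,2) bounds(3)[OF t]] N(2)
              summable_abs_geometric_bound[OF bounds(1,2) bounds(4)[OF t]]])
      finally show "(\<Sum>m. K (i + m * N)) = (\<Sum>j=0..<N. F N j)" ..
    qed
  qed
  \<comment> \<open>The number of terms is fixed, so limits can be taken termwise. The full sum has
    the same limit, and the difference yields the second claim.\<close>
  moreover have "(\<lambda>N. \<Sum>j\<le>i. F N j) \<longlonglongrightarrow> K i"
    unfolding K_def
  proof (rule tendsto_sum)
    fix j assume "j \<in> {..i}"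
    then have j: "j \<le> i" by simp
    show "(\<lambda>N. F N j) \<longlonglongrightarrow> \<psi> j t * \<psi> (i - j) t"
    proof (rule Lim_transform_eventually)
      show "(\<lambda>N. (\<Sum>m. \<psi> (j + m * N) t) * (\<Sum>m. \<psi> (i - j + m * N) t)) \<longlonglongrightarrow> \<psi> j t * \<psi> (i - j) t"
        by (intro tendsto_mult tendsto_progression_suminf[OF bounds(1,2) bounds(3)[OF t]])
      show "\<forall>\<^sub>F N in sequentially. (\<Sum>m. \<psi> (j + m * N) t) * (\<Sum>m. \<psi> (i - j + m * N) t) = F N j"
      proof (rule eventually_sequentiallyI)
        fix N assume N: "i + 2 \<le> N"
        \<comment> \<open>For \<open>j \<le> i < N\<close> exactly one period is removed.\<close>
        then have "(N + i - j) mod N = i - j" using j by (simp add: mod_if)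
        then show "(\<Sum>m. \<psi> (j + m * N) t) * (\<Sum>m. \<psi> (i - j + m * N) t) = F N j"
          using F[of N j] N j by simp
      qed
    qed
  qed
  ultimately have diff: "(\<lambda>N. (\<Sum>j=0..<N. F N j) - (\<Sum>j\<le>i. F N j)) \<longlonglongrightarrow> K i - K i"
    by (rule tendsto_diff)
  have "(\<lambda>N. \<Sum>j=i+1..<N. F N j) \<longlonglongrightarrow> 0"
  proof (rule Lim_transform_eventually)
    show "(\<lambda>N. (\<Sum>j=0..<N. F N j) - (\<Sum>j\<le>i. F N j)) \<longlonglongrightarrow> 0" using diff by simp
    show "\<forall>\<^sub>F N in sequentially. (\<Sum>j=0..<N. F N j) - (\<Sum>j\<le>i. F N j) = (\<Sum>j=i+1..<N. F N j)"
    proof (rule eventually_sequentiallyI)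
      fix N assume "i + 1 \<le> N"
      then have "(\<Sum>j=0..<N. F N j) = (\<Sum>j\<in>{0..<i+1}. F N j) + (\<Sum>j=i+1..<N. F N j)"
        by (subst sum.atLeastLessThan_concat) auto
      moreover have "{0..<i+1} = {..i}" by auto
      ultimately have "(\<Sum>j=0..<N. F N j) = (\<Sum>j\<le>i. F N j) + (\<Sum>j=i+1..<N. F N j)"
        by (simp only:)
      then show "(\<Sum>j=0..<N. F N j) - (\<Sum>j\<le>i. F N j) = (\<Sum>j=i+1..<N. F N j)" by simp
    qed
  qed
  with \<open>(\<lambda>N. \<Sum>j=0..<N. F N j) \<longlonglongrightarrow> K i\<close>
  show "((\<lambda>N. \<Sum>j=0..<N. \<phi> N (int j) t * \<phi> N (int N + int i - int j) t)
        \<longlonglongrightarrow> (\<Sum>j=0..i. \<psi> j t * \<psi> (i - j) t)) \<and>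
     ((\<lambda>N. \<Sum>j=i+1..<N. \<phi> N (int j) t * \<phi> N (int N + int i - int j) t)
        \<longlonglongrightarrow> 0)"
    unfolding F_def K_def atMost_atLeast0 by simp
qed

end
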